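(* Let $g\colon\mathbb{R}^n\to\mathbb{R}\cup\{\infty\}$ be a polyhedral convex function and let $h\colon\mathbb{R}^n\to\mathbb{R}\cup\{\infty\}$ be a convex function. Then the problem $$\min_{x\in\operatorname{dom} g}\,[g(x)-h(x)]$$ has an optimal solution if and only if the following three properties hold: (i) $\operatorname{dom} g\neq\emptyset$; (ii) $\operatorname{dom} g\subseteq\operatorname{dom} h$; (iii) $0^+\operatorname{epi} g\subseteq 0^+\bigl(\operatorname{epi} h\cap(\operatorname{dom} g\times\mathbb{R})\bigr)$.
   Context: For $f\colon\mathbb{R}^n\to\mathbb{R}\cup\{\infty\}$, $\operatorname{dom} f=\{x\in\mathbb{R}^n\mid f(x)<\infty\}$ and $\operatorname{epi} f=\{(x,r)\in\mathbb{R}^n\times\mathbb{R}\mid r\ge f(x)\}$. A convex function is called polyhedral if its epigraph is a convex polyhedron (a finite intersection of closed half-spaces). The recession cone of a convex set $C$ is $0^+C=\{y\mid C+\{y\}\subseteq C\}$. For $x\in\operatorname{dom} g\setminus\operatorname{dom} h$ one has $g(x)-h(x)=-\infty$. An optimal solution of the problem is a point $x^0\in\operatorname{dom} g$ such that $g(x^0)-h(x^0)$ is finite (i.e. $x^0\in\operatorname{dom} g\cap\operatorname{dom} h$) and $g(x^0)-h(x^0)\le g(x)-h(x)$ for all $x\in\operatorname{dom} g$. *)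

theory Defs
  imports "HOL-Analysis.Analysis"
begin

text \<open>
  Functions into the reals extended by \<open>\<infinity>\<close> are \<^typ>\<open>ereal\<close>-valued functions that never take
  the value \<open>-\<infinity>\<close>; the latter is a separate assumption wherever it is needed.
\<close>

definition effective_domain :: "('a \<Rightarrow> ereal) \<Rightarrow> 'a set" where
  "effective_domain f = {x. f x < \<infinity>}"

text \<open>The library constant \<^const>\<open>epigraph\<close> is restricted to real-valued functions.\<close>

definition epi :: "('a \<Rightarrow> ereal) \<Rightarrow> ('a \<times> real) set" where
  "epi f = {(x, r). ereal r \<ge> f x}"

definition convex_fun :: "('a::real_vector \<Rightarrow> ereal) \<Rightarrow> bool" where
  "convex_fun f \<longleftrightarrow> convex (epi f)"

definition polyhedral_convex_fun :: "('a::euclidean_space \<Rightarrow> ereal) \<Rightarrow> bool" where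
  "polyhedral_convex_fun f \<longleftrightarrow> convex_fun f \<and> polyhedron (epi f)"

definition recession_cone :: "'a::real_vector set \<Rightarrow> 'a set" where
  "recession_cone C = {y. (\<lambda>x. x + y) ` C \<subseteq> C}"

text \<open>
  Feasible points are those of the effective domain of \<open>g\<close>, where \<open>g x\<close> is finite. Hence
  \<^typ>\<open>ereal\<close> subtraction gives \<open>g x - h x = -\<infinity>\<close> when \<open>h x = \<infinity>\<close>, and the ambiguous
  difference \<open>\<infinity> - \<infinity>\<close> never occurs.
\<close>

definition optimal_solution :: "('a \<Rightarrow> ereal) \<Rightarrow> ('a \<Rightarrow> ereal) \<Rightarrow> 'a \<Rightarrow> bool" where
  "optimal_solution g h x0 \<longleftrightarrow>
     x0 \<in> effective_domain g \<and> \<bar>g x0 - h x0\<bar> \<noteq> \<infinity> \<and>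
     (\<forall>x\<in>effective_domain g. g x0 - h x0 \<le> g x - h x)"

end

(* Both directions are read off the epigraphs: a real c bounds g - h from below on dom g iff
   epi g shifted down by c lies in C = epi h \<inter> (dom g \<times> \<real>). If such a bound exists, then along
   a recession direction (y, s) of epi g the convex function t \<mapsto> h (x + t y) - t s is bounded
   above, hence nonincreasing, which is (iii). Conversely, epi g lies in conv P + 0\<^sup>+ epi g for
   a finite subset P of epi g. Shifting P down by the minimum c of r - h x over (x, r) \<in> P moves
   it into the convex set C; by (iii) all of epi g then moves into C, so c is a lower bound for
   g - h, and it is attained at a point of P. *)
theory Submission
  imports Defs
begin

section \<open>Polyhedra modulo their recession cones\<close>

lemma recession_cone_Int_halfspaces:
  assumes "S = \<Inter>F" and "\<And>H. H \<in> F \<Longrightarrow> H = {x. a H \<bullet> x \<le> b H}"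
    and "\<And>H. H \<in> F \<Longrightarrow> a H \<bullet> d \<le> 0"
  shows "d \<in> recession_cone S"
proof -
  have "x + d \<in> H" if "x \<in> S" "H \<in> F" for x H
  proof -
    have "a H \<bullet> x \<le> b H"
      using that assms(1,2) by blast
    then have "a H \<bullet> (x + d) \<le> b H"
      using assms(3)[OF that(2)] by (simp add: inner_add_right)
    then show ?thesis
      using assms(2)[OF that(2)] by blast
  qed
  then show ?thesis
    using assms(1) by (auto simp: recession_cone_def)
qed

text \<open>One half of the Minkowski-Weyl decomposition. As \<open>S\<close> may contain lines and
  thus lack vertices, \<open>P\<close> takes one representative for each set of constraints that are
  simultaneously tight at some point of \<open>S\<close>. Finitely many constraints have finitely
  many such sets. The induction is on the number of constraints that are not tight.\<close>

lemma polyhedron_subset_convex_hull_plus_recession_cone: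
  fixes S :: "'a::euclidean_space set"
  assumes "polyhedron S"
  obtains P where "finite P" "P \<subseteq> S"
    "\<And>x. x \<in> S \<Longrightarrow> \<exists>q\<in>convex hull P. x - q \<in> recession_cone S"
proof -
  obtain F where F: "finite F" "S = \<Inter>F"
    "\<forall>H\<in>F. \<exists>a b. a \<noteq> 0 \<and> H = {x::'a. a \<bullet> x \<le> b}"
    using assms by (auto simp: polyhedron_def)
  then obtain a b where ab: "\<And>H. H \<in> F \<Longrightarrow> H = {x. a H \<bullet> x \<le> b H}"
    by metis
  have mem_S: "x \<in> S \<longleftrightarrow> (\<forall>H\<in>F. a H \<bullet> x \<le> b H)" for x
    using F(2) ab by blast
  define tight where "tight x = {H \<in> F. a H \<bullet> x = b H}" for x
  \<comment> \<open>The choice depends on the tight set alone, which makes \<open>P\<close> finite.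
    It is only applied to sets \<open>tight x\<close> with \<open>x\<close> in \<open>S\<close>,
    where \<open>x\<close> itself is a witness.\<close>
  define p where "p J = (SOME x. x \<in> S \<and> J \<subseteq> tight x)" for J
  have p: "p (tight x) \<in> S" "tight x \<subseteq> tight (p (tight x))" if "x \<in> S" for x
    using someI[of "\<lambda>y. y \<in> S \<and> tight x \<subseteq> tight y" x] that by (auto simp: p_def)
  define P where "P = (\<lambda>x. p (tight x)) ` S"
  have "P \<subseteq> p ` Pow F"
    by (auto simp: P_def tight_def)
  then have fin: "finite P"
    using F(1) finite_subset by blast
  \<comment> \<open>Follow the ray from \<open>p (tight x)\<close> through \<open>x\<close>. Either it stays in \<open>S\<close>, or it leaves \<open>S\<close> at
    a point with strictly more tight constraints, and \<open>x\<close> lies between that point and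
    \<open>p (tight x)\<close>.\<close>
  have decomposition: "\<exists>q\<in>convex hull P. \<forall>H\<in>F. a H \<bullet> (x - q) \<le> 0" if "x \<in> S" for x
    using that
  proof (induction "card (F - tight x)" arbitrary: x rule: less_induct)
    case less
    define v where "v = p (tight x)"
    have vS: "v \<in> S" and vt: "tight x \<subseteq> tight v"
      using p[OF less.prems] by (simp_all add: v_def)
    have vP: "v \<in> convex hull P"
      using less.prems by (auto simp: v_def P_def intro!: hull_inc)
    define U where "U = {H \<in> F. a H \<bullet> (x - v) > 0}"
    show ?case
    proof (cases "U = {}")
      case True
      then show ?thesis
        using vP by (force simp: U_def not_less)
    next
      case False
      \<comment> \<open>Beyond \<open>x\<close>, the ray meets the bounding hyperplane of
        \<open>H\<close> after the multiple \<open>\<tau> H\<close> of \<open>x - v\<close>; hence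
        \<open>t\<close> marks the first exit from \<open>S\<close>.\<close>
      define \<tau> where "\<tau> H = (b H - a H \<bullet> x) / (a H \<bullet> (x - v))" for H
      define t where "t = Min (\<tau> ` U)"
      have finU: "finite U"
        using F(1) by (simp add: U_def)
      have "t \<in> \<tau> ` U"
        unfolding t_def using finU False by (intro Min_in) auto
      then obtain H0 where H0: "H0 \<in> U" "t = \<tau> H0"
        by blast
      have t_le: "t \<le> \<tau> H" if "H \<in> U" for H
        unfolding t_def using finU that by simp
      have t0: "t \<ge> 0"
        using H0 less.prems by (auto simp: \<tau>_def U_def mem_S intro!: divide_nonneg_pos)
      define x' where "x' = x + t *\<^sub>R (x - v)"
      have ax': "a H \<bullet> x' = a H \<bullet> x + t * (a H \<bullet> (x - v))" for H
        by (simp add: x'_def inner_add_right)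
      have x'S: "x' \<in> S"
        unfolding mem_S
      proof
        fix H assume H: "H \<in> F"
        show "a H \<bullet> x' \<le> b H"
        proof (cases "H \<in> U")
          case True
          then have "t * (a H \<bullet> (x - v)) \<le> b H - a H \<bullet> x"
            using t_le[OF True] by (simp add: \<tau>_def U_def pos_le_divide_eq)
          then show ?thesis
            by (simp add: ax')
        next
          case False
          then have "t * (a H \<bullet> (x - v)) \<le> 0"
            using H t0 by (simp add: U_def mult_nonneg_nonpos)
          moreover have "a H \<bullet> x \<le> b H"
            using less.prems H by (simp add: mem_S)
          ultimately show ?thesis
            by (simp add: ax')
        qed
      qed
      \<comment> \<open>A constraint tight at \<open>x\<close> is tight at \<open>v\<close> too,
        hence constant along the line through both. \<open>H0\<close> strictly increases along it,
        so it becomes tight only at \<open>x'\<close>.\<close>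
      have "tight x \<subseteq> tight x'"
        using vt by (auto simp: tight_def ax' inner_diff_right)
      moreover have "H0 \<in> tight x'"
        using H0 by (simp add: tight_def ax' \<tau>_def U_def)
      moreover have "H0 \<notin> tight x"
        using H0(1) vt by (auto simp: tight_def U_def inner_diff_right)
      moreover have "H0 \<in> F"
        using H0(1) by (simp add: U_def)
      ultimately have "card (F - tight x') < card (F - tight x)"
        using F(1) by (intro psubset_card_mono) auto
      from less.hyps[OF this x'S] obtain q
        where q: "q \<in> convex hull P" "\<forall>H\<in>F. a H \<bullet> (x' - q) \<le> 0"
        by blast
      \<comment> \<open>This weight solves \<open>x = u *\<^sub>R x' + (1 - u) *\<^sub>R v\<close>;
        putting \<open>q\<close> in place of \<open>x'\<close> gives \<open>w\<close>.\<close>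
      define u where "u = 1 / (1 + t)"
      have u: "0 \<le> u" "u \<le> 1" "u * (1 + t) = 1"
        using t0 by (simp_all add: u_def)
      define w where "w = u *\<^sub>R q + (1 - u) *\<^sub>R v"
      have w: "w \<in> convex hull P"
        unfolding w_def using u q(1) vP by (intro convexD[OF convex_convex_hull]) auto
      have "u *\<^sub>R (x' - q) = (u * (1 + t)) *\<^sub>R x - (u * (1 + t) - u) *\<^sub>R v - u *\<^sub>R q"
        by (simp add: x'_def algebra_simps)
      also have "\<dots> = x - w"
        unfolding u(3) w_def by (simp add: algebra_simps)
      finally have "x - w = u *\<^sub>R (x' - q)" ..
      then have "\<forall>H\<in>F. a H \<bullet> (x - w) \<le> 0"
        using q(2) u(1) by (simp add: mult_nonneg_nonpos)
      then show ?thesis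
        using w by blast
    qed
  qed
  show thesis
  proof (rule that[OF fin])
    show "P \<subseteq> S"
      using p(1) by (auto simp: P_def)
    show "\<exists>q\<in>convex hull P. x - q \<in> recession_cone S" if "x \<in> S" for x
      using decomposition[OF that] recession_cone_Int_halfspaces[OF F(2) ab] by blast
  qed
qed

section \<open>Recession directions and effective domains\<close>

lemma recession_cone_scaleR_nat:
  assumes "y \<in> recession_cone C" "x \<in> C"
  shows "x + real k *\<^sub>R y \<in> C"
proof (induction k)
  case (Suc k)
  then have "(x + real k *\<^sub>R y) + y \<in> C"
    using assms(1) by (auto simp: recession_cone_def)
  then show ?case
    by (simp add: algebra_simps)
qed (use assms in simp)

lemma convex_effective_domain:
  assumes "convex_fun f"
  shows "convex (effective_domain f)"
proof -
  have "effective_domain f = fst ` epi f"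
  proof
    show "effective_domain f \<subseteq> fst ` epi f"
    proof
      fix x assume "x \<in> effective_domain f"
      then obtain r where "f x \<le> ereal r"
        by (cases "f x") (auto simp: effective_domain_def)
      then show "x \<in> fst ` epi f"
        by (force simp: epi_def)
    qed
  qed (auto simp: effective_domain_def epi_def intro: le_less_trans)
  then show ?thesis
    using assms by (simp add: convex_fun_def convex_linear_image linear_fst)
qed

theorem theorem1:
  fixes g h :: "real ^ 'n \<Rightarrow> ereal"
  assumes "\<And>x. g x \<noteq> -\<infinity>" and "\<And>x. h x \<noteq> -\<infinity>"
    and "polyhedral_convex_fun g"
    and "convex_fun h"
  shows "(\<exists>x0. optimal_solution g h x0) \<longleftrightarrow>
    effective_domain g \<noteq> {} \<and>
    effective_domain g \<subseteq> effective_domain h \<and>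
    recession_cone (epi g) \<subseteq> recession_cone (epi h \<inter> effective_domain g \<times> UNIV)"
proof -
  have g_real: "\<exists>r. g x = ereal r" if "x \<in> effective_domain g" for x
    using that assms(1)[of x] by (cases "g x") (auto simp: effective_domain_def)
  have h_real: "\<exists>r. h x = ereal r" if "x \<in> effective_domain h" for x
    using that assms(2)[of x] by (cases "h x") (auto simp: effective_domain_def)
  have dom_g: "x \<in> effective_domain g" if "(x, r) \<in> epi g" for x r
    using that by (auto simp: effective_domain_def epi_def intro: le_less_trans)
  show ?thesis
  proof
    assume "\<exists>x0. optimal_solution g h x0"
    then obtain x0 where x0: "x0 \<in> effective_domain g" "\<bar>g x0 - h x0\<bar> \<noteq> \<infinity>"
      and le: "\<And>x. x \<in> effective_domain g \<Longrightarrow> g x0 - h x0 \<le> g x - h x"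
      by (auto simp: optimal_solution_def)
    obtain m where m: "g x0 - h x0 = ereal m"
      using x0(2) by (cases "g x0 - h x0") auto
    have sub: "effective_domain g \<subseteq> effective_domain h"
    proof
      fix x assume x: "x \<in> effective_domain g"
      \<comment> \<open>Otherwise \<open>g x - h x\<close> would be \<open>-\<infinity>\<close>,
        below the real number \<open>m\<close>.\<close>
      then show "x \<in> effective_domain h"
        using le[OF x] m g_real[OF x] by (cases "h x") (auto simp: effective_domain_def)
    qed
    have shift: "(x, r - m) \<in> epi h" if "(x, r) \<in> epi g" for x r
    proof -
      have x: "x \<in> effective_domain g"
        using that by (rule dom_g)
      with sub obtain u v where "g x = ereal u" "h x = ereal v"
        using g_real h_real by blast
      then show ?thesis
        using le[OF x] m that by (auto simp: epi_def)
    qed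
    have "(y, s) \<in> recession_cone (epi h \<inter> effective_domain g \<times> UNIV)"
      if ys: "(y, s) \<in> recession_cone (epi g)" for y s
    proof -
      have "(x + y, r + s) \<in> epi h \<inter> effective_domain g \<times> UNIV"
        if xr: "(x, r) \<in> epi h" and x: "x \<in> effective_domain g" for x r
      proof -
        \<comment> \<open>The ray has to start on the graph of \<open>g\<close>, because
          \<open>(x, r)\<close> is only known to lie in \<open>epi h\<close>.\<close>
        obtain gx where gx: "g x = ereal gx"
          using g_real[OF x] by blast
        then have "(x, gx) \<in> epi g"
          by (simp add: epi_def)
        then have ray: "(x + real k *\<^sub>R y, gx + real k * s) \<in> epi g" for k
          using recession_cone_scaleR_nat[OF ys, of "(x, gx)" k] by simp
        have dom: "x + y \<in> effective_domain g"
          using dom_g[OF ray[of 1]] by simp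
        then obtain v where v: "h (x + y) = ereal v"
          using sub h_real by blast
        \<comment> \<open>Join \<open>(x, r)\<close> to the point at parameter \<open>Suc n\<close>
          of the ray, lowered by \<open>m\<close>. The weight \<open>1 / Suc n\<close> on that point
          puts the combination exactly over \<open>x + y\<close>, and the mismatch
          \<open>gx - m - r\<close> of the starting heights fades as \<open>n\<close> grows.\<close>
        have bound: "v \<le> r + s + (gx - m - r) * inverse (real (Suc n))" for n
        proof -
          define u where "u = inverse (real (Suc n))"
          have u: "0 \<le> u" "u \<le> 1" "u * real (Suc n) = 1"
            by (simp_all add: u_def field_simps)
          have "(1 - u) *\<^sub>R (x, r) + u *\<^sub>R (x + real (Suc n) *\<^sub>R y, gx + real (Suc n) * s - m) \<in> epi h"
            using assms(4) u xr shift[OF ray[of "Suc n"]]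
            by (intro convexD) (auto simp: convex_fun_def)
          also have "(1 - u) *\<^sub>R (x, r) + u *\<^sub>R (x + real (Suc n) *\<^sub>R y, gx + real (Suc n) * s - m)
            = (x + (u * real (Suc n)) *\<^sub>R y, r + (u * real (Suc n)) * s + (gx - m - r) * u)"
            by (simp add: algebra_simps)
          finally show ?thesis
            unfolding u(3) using v by (simp add: epi_def u_def)
        qed
        have "(\<lambda>n. r + s + (gx - m - r) * inverse (real (Suc n))) \<longlonglongrightarrow> r + s + (gx - m - r) * 0"
          by (intro tendsto_intros LIMSEQ_inverse_real_of_nat)
        then have "v \<le> r + s + (gx - m - r) * 0"
          using bound by (intro LIMSEQ_le_const) auto
        then show ?thesis
          using v dom by (simp add: epi_def)
      qed
      then show ?thesis
        by (auto simp: recession_cone_def)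
    qed
    then show "effective_domain g \<noteq> {} \<and> effective_domain g \<subseteq> effective_domain h \<and>
      recession_cone (epi g) \<subseteq> recession_cone (epi h \<inter> effective_domain g \<times> UNIV)"
      using x0(1) sub by auto
  next
    let ?C = "epi h \<inter> effective_domain g \<times> UNIV"
    assume "effective_domain g \<noteq> {} \<and> effective_domain g \<subseteq> effective_domain h \<and>
      recession_cone (epi g) \<subseteq> recession_cone ?C"
    then have ne: "effective_domain g \<noteq> {}" and sub: "effective_domain g \<subseteq> effective_domain h"
      and rec: "recession_cone (epi g) \<subseteq> recession_cone ?C"
      by auto
    obtain P where P: "finite P" "P \<subseteq> epi g"
      "\<And>z. z \<in> epi g \<Longrightarrow> \<exists>q\<in>convex hull P. z - q \<in> recession_cone (epi g)"
      using assms(3) polyhedron_subset_convex_hull_plus_recession_cone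
      unfolding polyhedral_convex_fun_def by metis
    obtain x1 r1 where "g x1 = ereal r1"
      using ne g_real by blast
    then have "(x1, r1) \<in> epi g"
      by (simp add: epi_def)
    \<comment> \<open>The convex hull of the empty set is empty and could not serve
      \<open>(x1, r1)\<close>. The minimum below requires this.\<close>
    then have "P \<noteq> {}"
      using P(3) by fastforce
    \<comment> \<open>The value 0 of \<open>real_of_ereal\<close> at infinity does no harm: points
      of \<open>P\<close> lie over \<open>effective_domain g\<close>, where \<open>h\<close> is
      finite.\<close>
    define \<phi> where "\<phi> = (\<lambda>(x, r). r - real_of_ereal (h x))"
    define c where "c = Min (\<phi> ` P)"
    have "c \<in> \<phi> ` P"
      unfolding c_def using P(1) \<open>P \<noteq> {}\<close> by (intro Min_in) auto
    then obtain x0 r0 where x0: "(x0, r0) \<in> P" "c = r0 - real_of_ereal (h x0)"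
      by (auto simp: \<phi>_def)
    have shift_P: "(\<lambda>z. (0, - c) + z) ` P \<subseteq> ?C"
    proof (rule image_subsetI)
      fix z assume "z \<in> P"
      then obtain x r where z: "z = (x, r)" and xr: "(x, r) \<in> P"
        by (cases z) auto
      then have x: "x \<in> effective_domain g"
        using P(2) dom_g by blast
      then obtain v where v: "h x = ereal v"
        using sub h_real by blast
      have "c \<le> \<phi> (x, r)"
        unfolding c_def using P(1) xr by simp
      then show "(0, - c) + z \<in> ?C"
        using v x by (simp add: z \<phi>_def epi_def)
    qed
    have "convex (effective_domain g)"
      using assms(3) by (simp add: polyhedral_convex_fun_def convex_effective_domain)
    then have "convex ?C"
      using assms(4) by (auto simp: convex_fun_def intro!: convex_Int convex_Times)
    with shift_P have "convex hull ((\<lambda>z. (0, - c) + z) ` P) \<subseteq> ?C"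
      by (rule hull_minimal)
    then have hull: "(0, - c) + q \<in> ?C" if "q \<in> convex hull P" for q
      using that unfolding convex_hull_translation by blast
    have shift: "(0, - c) + z \<in> ?C" if z: "z \<in> epi g" for z
    proof -
      obtain q where q: "q \<in> convex hull P" "z - q \<in> recession_cone ?C"
        using P(3)[OF z] rec by blast
      then have "((0, - c) + q) + (z - q) \<in> ?C"
        using hull[OF q(1)] by (simp only: recession_cone_def mem_Collect_eq image_subset_iff)
      moreover have "((0, - c) + q) + (z - q) = (0, - c) + z"
        by simp
      ultimately show ?thesis
        by (simp only:)
    qed
    have lower: "ereal c \<le> g x - h x" if x: "x \<in> effective_domain g" for x
    proof -
      obtain u v where uv: "g x = ereal u" "h x = ereal v"
        using x sub g_real h_real by blast
      then have "(x, u) \<in> epi g"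
        by (simp add: epi_def)
      then show ?thesis
        using shift[of "(x, u)"] uv by (simp add: epi_def)
    qed
    have x0_epi: "(x0, r0) \<in> epi g"
      using x0(1) P(2) by blast
    then have x0_dom: "x0 \<in> effective_domain g"
      by (rule dom_g)
    then obtain u v where uv: "g x0 = ereal u" "h x0 = ereal v"
      using sub g_real h_real by blast
    \<comment> \<open>\<open>(x0, r0)\<close> might lie above the graph of \<open>g\<close>, so its
      choice yields only \<open>g x0 - h x0 \<le> c\<close>; the lower bound \<open>c\<close> gives
      equality.\<close>
    then have "g x0 - h x0 = ereal c"
      using x0(2) x0_epi lower[OF x0_dom] by (simp add: epi_def)
    then have "optimal_solution g h x0"
      using x0_dom lower by (simp add: optimal_solution_def)
    then show "\<exists>x0. optimal_solution g h x0" ..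
  qed
qed

end
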